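(* Let $A,B,C,\kappa\in\mathbb{C}$ and let $D$ be a negative integer. Then $$ {}_{5}F_{4}\left(\begin{matrix} A,\;1+A/2,\;B,\;C,\;D \\ A/2,\;\kappa-B,\;\kappa-C,\;\kappa-D \end{matrix}\right) =\frac{\Gamma(\kappa-B)\Gamma(\kappa-C)\Gamma(\kappa-D)\Gamma(\kappa-B-C-D)}{\Gamma(\kappa)\Gamma(\kappa-B-C)\Gamma(\kappa-B-D)\Gamma(\kappa-C-D)}\; {}_{5}F_{4}\left(\begin{matrix} \Delta(\kappa-A-1,2),\;B,\;C,\;D \\ \Delta(\kappa,2),\;\kappa-A,\;B+C+D-\kappa+1 \end{matrix}\right). $$
   Context: ${}_pF_q$ denotes the generalized hypergeometric series evaluated at unit argument; $\Delta(a,2)=(a/2,(a+1)/2)$. Standing convention: lower parameters are never non-positive integers, and the Gamma functions occurring are not evaluated at poles. *)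

theory Defs
  imports "HOL-Analysis.Analysis"
begin

(* The third argument of fps_hypergeo rescales the variable: its n-th coefficient carries c ^ n.
   The factor n! in the denominator is part of fps_hypergeo. *)
definition pFq_unit :: "complex list \<Rightarrow> complex list \<Rightarrow> complex" where
  "pFq_unit as bs = eval_fps (fps_hypergeo as bs 1) 1"

lemma pFq_unit_altdef:
  "pFq_unit as bs =
     (\<Sum>n. (\<Prod>a\<leftarrow>as. pochhammer a n) / ((\<Prod>b\<leftarrow>bs. pochhammer b n) * fact n))"
proof -
  have foldl_prod: "foldl (\<lambda>r x. r * pochhammer x n) c xs = c * (\<Prod>x\<leftarrow>xs. pochhammer x n)"
    for c :: complex and xs n
    by (induction xs arbitrary: c) (simp_all add: mult.assoc)
  show ?thesis
    by (simp add: pFq_unit_def eval_fps_def foldl_prod)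
qed

definition Delta2 :: "complex \<Rightarrow> complex list" where
  "Delta2 a = [a / 2, (a + 1) / 2]"

end

theory Submission
  imports Defs
begin

text \<open>
  Put \<open>D = -N\<close>. The very-well-poised factors \<open>(A)\<^sub>n (A + 2n) / (A n!)\<close> are the coefficients of
  \<open>(1 + x) (1 - x) powr (-A - 1)\<close>. Expanding \<open>(1 - x) powr (\<kappa> - 1 - A)\<close> in powers of
  \<open>x / (1 - x)\<^sup>2\<close> writes them as a combination of the corresponding factors with \<open>A\<close> replaced by
  \<open>\<kappa> - 1 + 2j\<close>. After interchanging the two summations, each inner sum is a well-poised
  terminating \<open>5F4\<close> with parameters \<open>B + j\<close>, \<open>C + j\<close>, \<open>D + j\<close>, which Dougall's theorem evaluates;
  the outer sum over \<open>j\<close> is the right-hand side.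
\<close>

section \<open>The connection formula\<close>

text \<open>Coefficients of \<open>(1 + x) (1 - x) powr (-k)\<close>. For \<open>k \<noteq> 1\<close> these are
  \<open>(k-1)\<^sub>m (k - 1 + 2m) / ((k-1) m!)\<close>; the form below also makes sense for \<open>k = 1\<close>.\<close>

definition vwp_weight :: "'a::field_char_0 \<Rightarrow> nat \<Rightarrow> 'a" where
  "vwp_weight k m = pochhammer k m / fact m
     + (case m of 0 \<Rightarrow> 0 | Suc i \<Rightarrow> pochhammer k i / fact i)"

text \<open>Coefficients of \<open>(1 - x) powr b\<close> as a power series in \<open>x / (1 - x)\<^sup>2\<close>; see
  \<open>pochhammer_double_conn_coeff\<close> for the form without case distinction.\<close>

definition conn_coeff :: "'a::field_char_0 \<Rightarrow> nat \<Rightarrow> 'a" where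
  "conn_coeff b j = (case j of 0 \<Rightarrow> 1
     | Suc i \<Rightarrow> (- 1) ^ j * b * pochhammer (b + of_nat j + 1) i / fact j)"

lemma vwp_weight_0 [simp]: "vwp_weight k 0 = 1"
  by (simp add: vwp_weight_def)

lemma vwp_weight_Suc:
  "vwp_weight k (Suc i) = pochhammer k i * (k + 2 * of_nat i + 1) / fact (Suc i)"
proof -
  have "1 + of_nat i \<noteq> (0 :: 'a)"
    by (metis of_nat_Suc of_nat_eq_0_iff nat.distinct(1))
  then show ?thesis
    by (simp add: vwp_weight_def pochhammer_Suc divide_simps) (simp add: algebra_simps)
qed

lemma conn_coeff_0 [simp]: "conn_coeff b 0 = 1"
  by (simp add: conn_coeff_def)

text \<open>With \<open>u = 1 - x\<close> and \<open>y = x / (1 - x)\<^sup>2\<close> this is \<open>u powr b - u powr (b + 1) = y * u powr (b + 2)\<close>.\<close>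

lemma conn_coeff_step:
  "conn_coeff b (Suc i) = conn_coeff (b + 1) (Suc i) + conn_coeff (b + 2) i"
proof (cases i)
  case 0
  then show ?thesis by (simp add: conn_coeff_def)
next
  case (Suc l)
  define p where "p = pochhammer (b + of_nat l + 4) l"
  have nz: "1 + of_nat l \<noteq> (0 :: 'a)" "2 + of_nat l \<noteq> (0 :: 'a)"
    by (metis of_nat_Suc of_nat_eq_0_iff nat.distinct(1),
        metis of_nat_Suc of_nat_eq_0_iff nat.distinct(1) add.assoc one_add_one)
  have p1: "pochhammer (b + of_nat (Suc (Suc l)) + 1) (Suc l) = (b + of_nat l + 3) * p"
    by (simp add: pochhammer_rec p_def algebra_simps)
  have p2: "pochhammer (b + 1 + of_nat (Suc (Suc l)) + 1) (Suc l) = p * (b + 2 * of_nat l + 4)"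
    by (simp add: pochhammer_Suc p_def algebra_simps)
  have p3: "pochhammer (b + 2 + of_nat (Suc l) + 1) l = p"
    by (simp add: p_def algebra_simps)
  have f: "fact (Suc (Suc l)) = (2 + of_nat l) * (fact (Suc l) :: 'a)"
    by (simp add: algebra_simps)
  \<comment> \<open>Both coefficients contain \<open>p\<close>; the remaining bracket factors as
    \<open>-(2 + l) (b + 2)\<close>, and \<open>2 + l\<close> cancels against the factorial.\<close>
  have "conn_coeff b (Suc i) - conn_coeff (b + 1) (Suc i)
      = (- 1) ^ l * p * (b * (b + of_nat l + 3) - (b + 1) * (b + 2 * of_nat l + 4))
          / ((2 + of_nat l) * fact (Suc l))"
    unfolding Suc conn_coeff_def nat.case p1 p2 f
    by (simp add: diff_divide_distrib[symmetric] del: fact_Suc) (simp add: algebra_simps del: fact_Suc)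
  also have "b * (b + of_nat l + 3) - (b + 1) * (b + 2 * of_nat l + 4)
      = - ((2 + of_nat l) * (b + 2))"
    by (simp add: algebra_simps)
  also have "(- 1) ^ l * p * - ((2 + of_nat l) * (b + 2)) / ((2 + of_nat l) * fact (Suc l))
      = conn_coeff (b + 2) i"
    unfolding Suc conn_coeff_def nat.case p3 using nz by (simp add: divide_simps)
  finally show ?thesis by (simp add: algebra_simps)
qed

text \<open>For \<open>j > 0\<close>, split \<open>(b)_{2j}\<close> as
  \<open>b (b+1)_j (b+j+1)_{j-1}\<close>; the outer two factors are those of
  \<open>conn_coeff\<close>. This later links the connection coefficients to the
  \<open>Delta2\<close> parameters.\<close>

lemma pochhammer_double_conn_coeff:
  "pochhammer b (2 * j) = (- 1) ^ j * conn_coeff b j * fact j * pochhammer (b + 1) j"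
proof (cases j)
  case (Suc i)
  have "pochhammer b (2 * j) = b * pochhammer (b + 1) (j + i)"
    unfolding Suc mult_2 add_Suc pochhammer_rec add_Suc_right ..
  also have "\<dots> = b * (pochhammer (b + 1) j * pochhammer (b + of_nat j + 1) i)"
    unfolding pochhammer_product' by (simp add: add_ac)
  finally show ?thesis
    using of_nat_neq_0[of i, where 'a = 'a]
    by (simp add: conn_coeff_def Suc mult_2 flip: power_mult_distrib)
qed simp

lemma poly_pochhammer_affine:
  "poly (\<Prod>i<n. [:c + of_nat i, s:]) x = pochhammer (c + x * s) n" for c :: "'a::field_char_0"
  by (simp add: poly_prod pochhammer_prod atLeast0LessThan add_ac)

text \<open>By \<open>conn_coeff_step\<close> the difference of the two sides is \<open>1\<close>-periodic in \<open>b\<close>. It vanishes at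
  \<open>b = 0\<close>, hence at all naturals, and it is a polynomial in \<open>b\<close>.\<close>

lemma pochhammer_fact_connection:
  "(\<Sum>j\<le>n. conn_coeff b j * pochhammer (k + 2 * of_nat j) (n - j) / fact (n - j))
     = pochhammer (k - b) n / fact n" for k b :: "'a::field_char_0"
proof (induction n arbitrary: k b)
  case 0
  then show ?case by simp
next
  case (Suc n)
  define S where "S b = (\<Sum>j\<le>Suc n. conn_coeff b j
    * pochhammer (k + 2 * of_nat j) (Suc n - j) / fact (Suc n - j))" for b
  define H where "H b = pochhammer (k - b) (Suc n) / fact (Suc n)" for b
  have S_step: "S b = S (b + 1) + pochhammer (k - b) n / fact n" for b
  proof -
    \<comment> \<open>The \<open>j = 0\<close> terms cancel, as both coefficients are 1. The rest is
      the sum of order \<open>n\<close> with \<open>k + 2\<close> and \<open>b + 2\<close>, whose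
      difference is again \<open>k - b\<close>.\<close>
    have "S b - S (b + 1) = (\<Sum>j\<le>n. conn_coeff (b + 2) j
        * pochhammer ((k + 2) + 2 * of_nat j) (n - j) / fact (n - j))"
      unfolding S_def sum.atMost_Suc_shift
      by (simp add: conn_coeff_step[of b] sum.distrib[symmetric] algebra_simps add_divide_distrib)
    then show ?thesis unfolding Suc.IH by (simp add: algebra_simps)
  qed
  have H_step: "H b = H (b + 1) + pochhammer (k - b) n / fact n" for b
  proof -
    have nz: "1 + of_nat n \<noteq> (0 :: 'a)"
      by (metis of_nat_Suc of_nat_eq_0_iff nat.distinct(1))
    have "pochhammer (k - b - 1) (Suc n) = (k - b - 1) * pochhammer (k - b) n"
      by (simp add: pochhammer_rec)
    then show ?thesis
      unfolding H_def using nz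
      by (simp add: pochhammer_Suc divide_simps diff_diff_eq) (simp add: algebra_simps)
  qed
  have eq_nat: "S (of_nat b) = H (of_nat b)" for b
  proof (induction b)
    case 0
    have "S 0 = (\<Sum>j\<in>{0}. conn_coeff 0 j
      * pochhammer (k + 2 * of_nat j) (Suc n - j) / fact (Suc n - j))"
      unfolding S_def by (rule sum.mono_neutral_right) (auto simp: conn_coeff_def split: nat.splits)
    then show ?case by (simp add: H_def)
  next
    case (Suc b)
    then show ?case using S_step[of "of_nat b"] H_step[of "of_nat b"] by (simp add: add_ac)
  qed
  \<comment> \<open>\<open>c j\<close> is \<open>conn_coeff b j\<close> as a polynomial in
    \<open>b\<close>; \<open>[:0, 1:]\<close> stands for the factor \<open>b\<close>.\<close>
  define c :: "nat \<Rightarrow> 'a poly" where "c j = (case j of 0 \<Rightarrow> 1 | Suc i \<Rightarrow>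
    smult ((- 1) ^ j / fact j) ([:0, 1:] * (\<Prod>l<i. [:of_nat j + 1 + of_nat l, 1:])))"
    for j
  have poly_c: "poly (c j) x = conn_coeff x j" for j and x :: 'a
  proof (cases j)
    case (Suc i)
    have "poly (\<Prod>l<i. [:of_nat j + 1 + of_nat l, 1:]) x = pochhammer (x + of_nat j + 1) i"
      unfolding poly_pochhammer_affine by (simp add: add_ac)
    then show ?thesis by (simp add: c_def conn_coeff_def Suc)
  qed (simp add: c_def)
  define P where "P = (\<Sum>j\<le>Suc n. smult (pochhammer (k + 2 * of_nat j) (Suc n - j)
    / fact (Suc n - j)) (c j))"
  define Q where "Q = smult (1 / fact (Suc n)) (\<Prod>i<Suc n. [:k + of_nat i, - 1:])"
  have poly_P: "poly P x = S x" for x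
    unfolding P_def S_def by (simp add: poly_sum poly_c mult_ac)
  have poly_Q: "poly Q x = H x" for x
    unfolding Q_def H_def by (simp only: poly_smult poly_pochhammer_affine) simp
  have "range of_nat \<subseteq> {x. poly (P - Q) x = 0}"
    by (auto simp: poly_P poly_Q eq_nat)
  then have "infinite {x. poly (P - Q) x = 0}"
    using infinite_UNIV_char_0 finite_subset finite_imageD inj_of_nat by blast
  then have "P = Q"
    using poly_roots_finite[of "P - Q"] by auto
  then show ?case using poly_P poly_Q by (metis S_def H_def)
qed

text \<open>This is the previous identity multiplied by \<open>1 + x\<close>: a weight adds two
  consecutive coefficients of \<open>(1 - x) powr (-k)\<close>, so the identity is used at
  \<open>n\<close> and at \<open>n - 1\<close>.\<close>

lemma vwp_weight_connection:
  "vwp_weight (k - b) n = (\<Sum>j\<le>n. conn_coeff b j * vwp_weight (k + 2 * of_nat j) (n - j))"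
proof (cases n)
  case 0
  then show ?thesis by simp
next
  case (Suc m)
  have "(\<Sum>j\<le>n. conn_coeff b j * vwp_weight (k + 2 * of_nat j) (n - j))
      = (\<Sum>j\<le>n. conn_coeff b j * pochhammer (k + 2 * of_nat j) (n - j) / fact (n - j))
      + (\<Sum>j\<le>m. conn_coeff b j * pochhammer (k + 2 * of_nat j) (m - j) / fact (m - j))"
    unfolding Suc by (simp add: vwp_weight_def Suc_diff_le algebra_simps sum.distrib)
  then show ?thesis
    unfolding pochhammer_fact_connection by (simp add: vwp_weight_def Suc)
qed

section \<open>Dougall's terminating well-poised sum\<close>

text \<open>In Dougall's sum \<open>k\<close> stands for \<open>1 + a\<close> with leading parameter
  \<open>a\<close>. Keeping the weight separate allows it to carry a different parameter, as on the
  left of the transformation.\<close>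

definition wp_term :: "'a::field_char_0 \<Rightarrow> 'a \<Rightarrow> 'a \<Rightarrow> 'a \<Rightarrow> nat \<Rightarrow> 'a" where
  "wp_term k B C D m = pochhammer B m * pochhammer C m * pochhammer D m
     / (pochhammer (k - B) m * pochhammer (k - C) m * pochhammer (k - D) m)"

lemma wp_term_0 [simp]: "wp_term k B C D 0 = 1"
  by (simp add: wp_term_def)

text \<open>Raising \<open>B\<close>, \<open>C\<close>, \<open>D\<close> by \<open>j\<close> and
  \<open>k\<close> by \<open>2j\<close> preserves well-poisedness, because
  \<open>(k + 2j) - (B + j) = (k - B) + j\<close>.\<close>

lemma wp_term_add:
  "wp_term k B C D (j + m) = wp_term k B C D j
     * wp_term (k + 2 * of_nat j) (B + of_nat j) (C + of_nat j) (D + of_nat j) m"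
  by (simp add: wp_term_def pochhammer_product' algebra_simps)

text \<open>The Wilf--Zeilberger telescoping behind the recurrence in \<open>D\<close>.\<close>

lemma dougall_telescope:
  fixes k B C D :: "'a::field_char_0"
  assumes "\<And>n. k - B + of_nat n \<noteq> 0" "\<And>n. k - C + of_nat n \<noteq> 0" "\<And>n. k - D + of_nat n \<noteq> 0"
  shows "(\<Sum>m\<le>M. vwp_weight k m * ((k - B - D) * (k - C - D) * wp_term k B C (D - 1) m
             - (k - D) * (k - B - C - D) * wp_term k B C D m))
         = (k - D) * pochhammer k M * pochhammer B (Suc M) * pochhammer C (Suc M) * pochhammer D M
             / (fact M * pochhammer (k - B) M * pochhammer (k - C) M * pochhammer (k - D) (Suc M))"
proof (induction M)
  case 0
  have "(k - B - D) * (k - C - D) - (k - D) * (k - B - C - D) = B * C"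
    by algebra
  then show ?case using assms(3)[of 0] by simp
next
  case (Suc M)
  define x where "x = (of_nat M :: 'a)"
  \<comment> \<open>\<open>K\<close> is the closed form at \<open>M\<close> without its factor
    \<open>k - D\<close>; all quantities at \<open>Suc M\<close> become rational multiples of
    it.\<close>
  define K where "K = pochhammer k M * pochhammer B (Suc M) * pochhammer C (Suc M)
    * pochhammer D M / (fact M * pochhammer (k - B) M * pochhammer (k - C) M * pochhammer (k - D) (Suc M))"
  have nz: "k - B + x \<noteq> 0" "k - C + x \<noteq> 0" "k - D + x + 1 \<noteq> 0" "x + 1 \<noteq> 0" "k - D \<noteq> 0"
    using assms(1,2)[of M] assms(3)[of "Suc M"] assms(3)[of 0] of_nat_neq_0[of M, where 'a = 'a]
    by (simp_all add: x_def add_ac)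
  define L where "L = (x + 1) * (k - B + x) * (k - C + x)"
  have poch_D: "pochhammer (D - 1) (Suc M) = (D - 1) * pochhammer D M"
    by (simp add: pochhammer_rec)
  have "(k - D) * pochhammer (k - (D - 1)) (Suc M) = pochhammer (k - D) (Suc (Suc M))"
    by (simp add: pochhammer_rec algebra_simps)
  also have "\<dots> = pochhammer (k - D) (Suc M) * (k - D + x + 1)"
    by (simp only: pochhammer_Suc[of _ "Suc M"]) (simp add: x_def add_ac)
  finally have poch_kD: "pochhammer (k - (D - 1)) (Suc M)
      = pochhammer (k - D) (Suc M) * (k - D + x + 1) / (k - D)"
    using nz by (simp add: field_simps)
  have t1: "vwp_weight k (Suc M) * wp_term k B C (D - 1) (Suc M)
      = K * (k + 2 * x + 1) * (D - 1) * (k - D) / (L * (k - D + x + 1))"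
    unfolding vwp_weight_Suc wp_term_def poch_D poch_kD K_def L_def
      pochhammer_Suc[of "k - B"] pochhammer_Suc[of "k - C"] x_def
    by (simp add: divide_simps mult_ac add_ac)
  have t2: "vwp_weight k (Suc M) * wp_term k B C D (Suc M) = K * (k + 2 * x + 1) * (D + x) / L"
    unfolding vwp_weight_Suc wp_term_def K_def L_def
      pochhammer_Suc[of "k - B"] pochhammer_Suc[of "k - C"] pochhammer_Suc[of D] x_def
    by (simp add: divide_simps mult_ac add_ac)
  have g: "(k - D) * pochhammer k (Suc M) * pochhammer B (Suc (Suc M)) * pochhammer C (Suc (Suc M))
        * pochhammer D (Suc M) / (fact (Suc M) * pochhammer (k - B) (Suc M)
        * pochhammer (k - C) (Suc M) * pochhammer (k - D) (Suc (Suc M)))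
      = K * (k - D) * (k + x) * (B + x + 1) * (C + x + 1) * (D + x) / (L * (k - D + x + 1))"
    unfolding K_def L_def pochhammer_Suc[of B "Suc M"] pochhammer_Suc[of C "Suc M"]
      pochhammer_Suc[of "k - D" "Suc M"] pochhammer_Suc[of k] pochhammer_Suc[of D]
      pochhammer_Suc[of "k - B"] pochhammer_Suc[of "k - C"] x_def
    by (simp add: divide_simps mult_ac add_ac)
  \<comment> \<open>The induction step after removing the common factor
    \<open>K (k - D) / (L (k - D + x + 1))\<close>.\<close>
  have "L * (k - D + x + 1) + (k + 2 * x + 1) * ((k - B - D) * (k - C - D) * (D - 1)
        - (k - B - C - D) * (D + x) * (k - D + x + 1))
      = (k + x) * (B + x + 1) * (C + x + 1) * (D + x)"
    unfolding L_def by algebra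
  \<comment> \<open>Variables replace the compound factors, so that clearing denominators does not
    expand them.\<close>
  moreover have "K * p * (L * y + q * (a * b * u - e * v * y)) / (L * y)
      = K * p + a * b * (K * q * u * p / (L * y)) - p * e * (K * q * v / L)"
    if "y \<noteq> 0" for p q a b u e v y :: 'a
  proof -
    have "L \<noteq> 0"
      using nz by (simp add: L_def)
    then show ?thesis
      using that by (simp add: field_simps)
  qed
  from this[OF nz(3)]
  have "K * (k - D) * (L * (k - D + x + 1) + (k + 2 * x + 1) * ((k - B - D) * (k - C - D) * (D - 1)
        - (k - B - C - D) * (D + x) * (k - D + x + 1))) / (L * (k - D + x + 1))
      = K * (k - D) + (k - B - D) * (k - C - D)
          * (K * (k + 2 * x + 1) * (D - 1) * (k - D) / (L * (k - D + x + 1)))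
        - (k - D) * (k - B - C - D) * (K * (k + 2 * x + 1) * (D + x) / L)" .
  ultimately have "K * (k - D) * (k + x) * (B + x + 1) * (C + x + 1) * (D + x) / (L * (k - D + x + 1))
      = K * (k - D) + (k - B - D) * (k - C - D)
          * (K * (k + 2 * x + 1) * (D - 1) * (k - D) / (L * (k - D + x + 1)))
        - (k - D) * (k - B - C - D) * (K * (k + 2 * x + 1) * (D + x) / L)"
    by (simp only: mult.assoc)
  moreover have "vwp_weight k (Suc M) * ((k - B - D) * (k - C - D) * wp_term k B C (D - 1) (Suc M)
             - (k - D) * (k - B - C - D) * wp_term k B C D (Suc M))
      = (k - B - D) * (k - C - D) * (vwp_weight k (Suc M) * wp_term k B C (D - 1) (Suc M))
        - (k - D) * (k - B - C - D) * (vwp_weight k (Suc M) * wp_term k B C D (Suc M))"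
    by (simp add: algebra_simps)
  moreover have "(k - D) * pochhammer k M * pochhammer B (Suc M) * pochhammer C (Suc M) * pochhammer D M
      / (fact M * pochhammer (k - B) M * pochhammer (k - C) M * pochhammer (k - D) (Suc M)) = K * (k - D)"
    by (simp add: K_def)
  ultimately show ?case
    unfolding sum.atMost_Suc Suc.IH g t1 t2 by simp
qed

text \<open>Induction on \<open>N\<close>. The telescoped sum up to \<open>N + 1\<close> with
  \<open>D = -N\<close> has boundary value zero, since \<open>(-N)_{N+1} = 0\<close>; this gives a
  two-term recurrence from \<open>D\<close> to \<open>D - 1\<close>.\<close>

theorem dougall_5F4_terminating:
  fixes k B C :: "'a::field_char_0"
  assumes k: "\<And>n. k + of_nat n \<noteq> 0"
    and B: "\<And>n. k - B + of_nat n \<noteq> 0" and C: "\<And>n. k - C + of_nat n \<noteq> 0"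
  shows "(\<Sum>m\<le>N. vwp_weight k m * wp_term k B C (- of_nat N) m)
       = pochhammer k N * pochhammer (k - B - C) N / (pochhammer (k - B) N * pochhammer (k - C) N)"
proof (induction N)
  case 0
  then show ?case by simp
next
  case (Suc N)
  define D where "D = - (of_nat N :: 'a)"
  have D_Suc: "- of_nat (Suc N) = D - 1"
    by (simp add: D_def)
  have kD: "k - D + of_nat n \<noteq> 0" for n
    using k[of "N + n"] by (simp add: D_def add_ac)
  have vanish: "pochhammer D (Suc N) = 0"
    by (simp add: D_def pochhammer_eq_0_iff)
  have "(\<Sum>m\<le>Suc N. vwp_weight k m * ((k - B - D) * (k - C - D) * wp_term k B C (D - 1) m
             - (k - D) * (k - B - C - D) * wp_term k B C D m)) = 0"
    using dougall_telescope[OF B C kD, of "Suc N"] vanish by simp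
  moreover have "(\<Sum>m\<le>Suc N. vwp_weight k m * ((k - B - D) * (k - C - D) * wp_term k B C (D - 1) m
             - (k - D) * (k - B - C - D) * wp_term k B C D m))
      = (k - B - D) * (k - C - D) * (\<Sum>m\<le>Suc N. vwp_weight k m * wp_term k B C (D - 1) m)
        - (k - D) * (k - B - C - D) * (\<Sum>m\<le>Suc N. vwp_weight k m * wp_term k B C D m)"
    by (simp only: sum_distrib_left sum_subtractf[symmetric]) (simp add: algebra_simps)
  \<comment> \<open>The term at \<open>Suc N\<close> vanishes for \<open>D = -N\<close>, so the
    induction hypothesis applies.\<close>
  moreover have "(\<Sum>m\<le>Suc N. vwp_weight k m * wp_term k B C D m)
      = pochhammer k N * pochhammer (k - B - C) N / (pochhammer (k - B) N * pochhammer (k - C) N)"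
    using Suc.IH vanish by (simp add: wp_term_def D_def)
  moreover have "k - B - D \<noteq> 0" "k - C - D \<noteq> 0"
    using B[of N] C[of N] by (simp_all add: D_def)
  ultimately have "(\<Sum>m\<le>Suc N. vwp_weight k m * wp_term k B C (D - 1) m)
      = (k - D) * (k - B - C - D) / ((k - B - D) * (k - C - D)) * (pochhammer k N
        * pochhammer (k - B - C) N / (pochhammer (k - B) N * pochhammer (k - C) N))"
    by (simp only: eq_divide_eq times_divide_eq_left) (simp add: mult_ac)
  then show ?case
    unfolding D_Suc by (simp add: pochhammer_Suc D_def mult_ac)
qed

section \<open>The transformation\<close>

lemma sum_triangle_swap:
  "(\<Sum>n\<le>N. \<Sum>j\<le>n. f j (n - j)) = (\<Sum>j\<le>N. \<Sum>m\<le>N - j. f j m)"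
  for f :: "nat \<Rightarrow> nat \<Rightarrow> 'a::comm_monoid_add"
proof -
  have "{(j, m). j + m \<le> N} = Sigma {..N} (\<lambda>j. {..N - j})"
    by auto
  then show ?thesis
    by (simp add: sum.triangle_reindex_eq[symmetric] sum.Sigma)
qed

lemma terminating_transformation:
  fixes k A B C :: "'a::field_char_0"
  assumes k: "\<And>n. k + of_nat n \<noteq> 0"
    and B: "\<And>n. k - B + of_nat n \<noteq> 0" and C: "\<And>n. k - C + of_nat n \<noteq> 0"
    and BC: "\<And>n. k - B - C + of_nat n \<noteq> 0"
  shows "(\<Sum>n\<le>N. vwp_weight (A + 1) n * wp_term k B C (- of_nat N) n)
    = pochhammer k N * pochhammer (k - B - C) N / (pochhammer (k - B) N * pochhammer (k - C) N)
      * (\<Sum>j\<le>N. (- 1) ^ j * conn_coeff (k - 1 - A) j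
          * (pochhammer B j * pochhammer C j * pochhammer (- of_nat N) j)
          / (pochhammer k (2 * j) * pochhammer (B + C - of_nat N - k + 1) j))"
proof -
  have poch_nz: "pochhammer z n \<noteq> 0" if "\<And>n. z + of_nat n \<noteq> 0" for z :: 'a and n
    using that by (auto simp: pochhammer_eq_0_iff add_eq_0_iff2)
  note nz = poch_nz[OF k] poch_nz[OF B] poch_nz[OF C] poch_nz[OF BC]
  define c where "c = conn_coeff (k - 1 - A)"
  define D where "D = - (of_nat N :: 'a)"
  have weight: "vwp_weight (A + 1) n
      = (\<Sum>j\<le>n. c j * vwp_weight (k + 2 * of_nat j) (n - j))" for n
    using vwp_weight_connection[of k "k - 1 - A" n] by (simp add: c_def algebra_simps)
  have inner: "(\<Sum>m\<le>N - j. vwp_weight (k + 2 * of_nat j) m * wp_term k B C D (j + m))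
      = pochhammer k N * pochhammer (k - B - C) N / (pochhammer (k - B) N * pochhammer (k - C) N)
        * ((- 1) ^ j * (pochhammer B j * pochhammer C j * pochhammer D j)
        / (pochhammer k (2 * j) * pochhammer (B + C + D - k + 1) j))" if jN: "j \<le> N" for j
  proof -
    \<comment> \<open>Since \<open>D + j = -M\<close>, the shifted inner sum terminates exactly at
      its upper limit \<open>M\<close>.\<close>
    obtain M where N: "N = j + M"
      using le_Suc_ex[OF jN] by blast
    have Dj: "D + of_nat j = - of_nat M"
      by (simp add: D_def N)
    have shift: "k + 2 * of_nat j - (B + of_nat j) = k - B + of_nat j"
      "k + 2 * of_nat j - (C + of_nat j) = k - C + of_nat j"
      "k - B + of_nat j - (C + of_nat j) = k - B - C"
      by (simp_all add: algebra_simps)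
    have "(\<Sum>m\<le>M. vwp_weight (k + 2 * of_nat j) m
        * wp_term (k + 2 * of_nat j) (B + of_nat j) (C + of_nat j) (- of_nat M) m)
      = pochhammer (k + 2 * of_nat j) M * pochhammer (k - B - C) M
        / (pochhammer (k - B + of_nat j) M * pochhammer (k - C + of_nat j) M)"
      using dougall_5F4_terminating[of "k + 2 * of_nat j" "B + of_nat j" "C + of_nat j" M]
        k[of "2 * j + n" for n] B[of "j + n" for n] C[of "j + n" for n]
      unfolding shift by (simp add: add.assoc)
    then have "(\<Sum>m\<le>N - j. vwp_weight (k + 2 * of_nat j) m * wp_term k B C D (j + m))
      = wp_term k B C D j * (pochhammer (k + 2 * of_nat j) M * pochhammer (k - B - C) M
        / (pochhammer (k - B + of_nat j) M * pochhammer (k - C + of_nat j) M))"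
      unfolding N wp_term_add Dj by (simp add: sum_distrib_left[symmetric] mult.left_commute)
    also have "\<dots> = pochhammer B j * pochhammer C j * pochhammer D j
        * (pochhammer (k + 2 * of_nat j) M / pochhammer (k - D) j) * pochhammer (k - B - C) M
        / (pochhammer (k - B) N * pochhammer (k - C) N)"
      unfolding N pochhammer_product' by (simp add: wp_term_def mult_ac)
    \<comment> \<open>Split \<open>(k)_{N+j}\<close> after \<open>2j\<close> factors and after
      \<open>N\<close> factors, using \<open>k - D = k + N\<close>.\<close>
    also have "pochhammer (k + 2 * of_nat j) M / pochhammer (k - D) j
        = pochhammer k N / pochhammer k (2 * j)"
    proof -
      have "pochhammer k (2 * j) * pochhammer (k + 2 * of_nat j) M = pochhammer k (N + j)"
      proof -
        have "N + j = 2 * j + M"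
          by (simp add: N)
        show ?thesis
          unfolding \<open>N + j = 2 * j + M\<close> pochhammer_product' by simp
      qed
      also have "\<dots> = pochhammer k N * pochhammer (k - D) j"
        by (simp add: pochhammer_product' D_def)
      finally show ?thesis
        using nz(1) poch_nz[of "k - D" j] k[of "N + n" for n]
        by (simp add: D_def divide_simps mult_ac add.assoc)
    qed
    \<comment> \<open>The last \<open>j\<close> factors of \<open>(k-B-C)_N\<close>, reversed and
      negated, form \<open>(B+C+D-k+1)_j\<close>.\<close>
    also have "pochhammer (k - B - C) M
        = pochhammer (k - B - C) N * ((- 1) ^ j / pochhammer (B + C + D - k + 1) j)"
    proof -
      have "pochhammer (k - B - C + of_nat M) j = (- 1) ^ j * pochhammer (B + C + D - k + 1) j"
        using pochhammer_minus[of "B + C - k - of_nat M" j] by (simp add: N D_def algebra_simps)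
      then have "pochhammer (k - B - C) N
          = pochhammer (k - B - C) M * ((- 1) ^ j * pochhammer (B + C + D - k + 1) j)"
        using pochhammer_product'[of "k - B - C" M j] by (simp add: N add.commute)
      then show ?thesis
        using nz(4)[of N] by (auto simp flip: power_mult_distrib)
    qed
    finally show ?thesis
      by (simp add: mult_ac)
  qed
  have "(\<Sum>n\<le>N. vwp_weight (A + 1) n * wp_term k B C D n)
      = (\<Sum>n\<le>N. \<Sum>j\<le>n. c j * (vwp_weight (k + 2 * of_nat j) (n - j) * wp_term k B C D (j + (n - j))))"
    unfolding weight sum_distrib_right by (intro sum.cong refl) (simp add: mult.assoc)
  also have "\<dots> = (\<Sum>j\<le>N. \<Sum>m\<le>N - j. c j * (vwp_weight (k + 2 * of_nat j) m * wp_term k B C D (j + m)))"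
    by (rule sum_triangle_swap[where
          f = "\<lambda>j m. c j * (vwp_weight (k + 2 * of_nat j) m * wp_term k B C D (j + m))"])
  also have "\<dots> = pochhammer k N * pochhammer (k - B - C) N / (pochhammer (k - B) N * pochhammer (k - C) N)
      * (\<Sum>j\<le>N. (- 1) ^ j * c j * (pochhammer B j * pochhammer C j * pochhammer D j)
          / (pochhammer k (2 * j) * pochhammer (B + C + D - k + 1) j))"
    unfolding sum_distrib_left[of _ _ "{..N}"]
    by (intro sum.cong refl, simp only: sum_distrib_left[symmetric] inner atMost_iff) (simp add: mult_ac)
  finally show ?thesis
    by (simp add: c_def D_def)
qed

section \<open>Translation to hypergeometric series and Gamma functions\<close>

text \<open>The quotient \<open>(1 + A/2)_n / (A/2)_n\<close> collapses to
  \<open>(A + 2n) / A\<close>, and for \<open>n > 0\<close> this \<open>A\<close> cancels the first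
  factor of \<open>(A)_n\<close>.\<close>

lemma well_poised_weight:
  fixes A :: "'a::field_char_0"
  assumes "\<And>n. A / 2 + of_nat n \<noteq> 0"
  shows "pochhammer A n * pochhammer (1 + A / 2) n / (pochhammer (A / 2) n * fact n)
    = vwp_weight (A + 1) n"
proof (cases n)
  case (Suc i)
  have nz: "A \<noteq> 0" "pochhammer (A / 2) n \<noteq> 0"
    using assms[of 0] assms by (auto simp: pochhammer_eq_0_iff add_eq_0_iff2)
  have "A / 2 * pochhammer (1 + A / 2) n = pochhammer (A / 2) n * (A / 2 + of_nat n)"
    by (metis pochhammer_rec pochhammer_Suc add.commute)
  then have "pochhammer (1 + A / 2) n / pochhammer (A / 2) n = (A + 2 * of_nat n) / A"
    using nz by (simp add: field_simps)
  moreover have "pochhammer A n = A * pochhammer (A + 1) i"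
    by (simp add: Suc pochhammer_rec)
  ultimately have "pochhammer A n * (pochhammer (1 + A / 2) n / pochhammer (A / 2) n) / fact n
      = pochhammer (A + 1) i * (A + 2 * of_nat n) / fact n"
    using nz by simp
  also have "\<dots> = vwp_weight (A + 1) n"
    unfolding Suc vwp_weight_Suc by (simp add: algebra_simps)
  finally show ?thesis
    by simp
qed simp

text \<open>The duplication formula for rising factorials. The powers of 4 later cancel between the
  upper and lower \<open>Delta2\<close> pairs.\<close>

lemma pochhammer_Delta2:
  "pochhammer (a / 2) n * pochhammer ((a + 1) / 2) n = pochhammer a (2 * n) / 4 ^ n"
  for a :: "'a::field_char_0"
  using pochhammer_double[of "a / 2" n] by (simp add: power_mult add_divide_distrib)

lemma nonpos_Ints_plus_of_nat_neq_0:
  "z \<notin> \<int>\<^sub>\<le>\<^sub>0 \<Longrightarrow> z + of_nat n \<noteq> 0"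
  by (auto simp: add_eq_0_iff2)

theorem mainTheorem14:
  fixes A B C D \<kappa> :: complex and d :: int
  assumes D_neg_int: "D = of_int d" "d < 0"
    and lower_left: "\<forall>b \<in> set [A / 2, \<kappa> - B, \<kappa> - C, \<kappa> - D]. b \<notin> \<int>\<^sub>\<le>\<^sub>0"
    and lower_right: "\<forall>b \<in> set (Delta2 \<kappa> @ [\<kappa> - A, B + C + D - \<kappa> + 1]). b \<notin> \<int>\<^sub>\<le>\<^sub>0"
    and Gamma_args: "\<forall>z \<in> {\<kappa> - B, \<kappa> - C, \<kappa> - D, \<kappa> - B - C - D,
                              \<kappa>, \<kappa> - B - C, \<kappa> - B - D, \<kappa> - C - D}. z \<notin> \<int>\<^sub>\<le>\<^sub>0"
  shows "pFq_unit [A, 1 + A / 2, B, C, D] [A / 2, \<kappa> - B, \<kappa> - C, \<kappa> - D] =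
         (Gamma (\<kappa> - B) * Gamma (\<kappa> - C) * Gamma (\<kappa> - D) * Gamma (\<kappa> - B - C - D)) /
         (Gamma \<kappa> * Gamma (\<kappa> - B - C) * Gamma (\<kappa> - B - D) * Gamma (\<kappa> - C - D)) *
         pFq_unit (Delta2 (\<kappa> - A - 1) @ [B, C, D])
                  (Delta2 \<kappa> @ [\<kappa> - A, B + C + D - \<kappa> + 1])"
proof -
  define N where "N = nat (- d)"
  have D: "D = - of_nat N"
    using D_neg_int by (simp add: N_def)
  \<comment> \<open>The factor \<open>(-N)_n\<close> truncates both infinite series to finite
    sums.\<close>
  have vanish: "pochhammer D n = 0" if "n \<notin> {..N}" for n
    using that by (simp add: D pochhammer_of_nat_eq_0_iff)
  note nonzero = nonpos_Ints_plus_of_nat_neq_0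
  have A: "A / 2 + of_nat n \<noteq> 0" for n
    using nonzero[of "A / 2"] lower_left by simp
  have \<kappa>A: "pochhammer (\<kappa> - A) n \<noteq> 0" for n
    using nonzero[of "\<kappa> - A"] lower_right by (auto simp: pochhammer_eq_0_iff add_eq_0_iff2)
  have left_term: "(\<Prod>a\<leftarrow>[A, 1 + A / 2, B, C, D]. pochhammer a n)
        / ((\<Prod>b\<leftarrow>[A / 2, \<kappa> - B, \<kappa> - C, \<kappa> - D]. pochhammer b n) * fact n)
      = vwp_weight (A + 1) n * wp_term \<kappa> B C D n" for n
    unfolding well_poised_weight[OF A, symmetric] by (simp add: wp_term_def mult_ac)
  have left: "pFq_unit [A, 1 + A / 2, B, C, D] [A / 2, \<kappa> - B, \<kappa> - C, \<kappa> - D]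
      = (\<Sum>n\<le>N. vwp_weight (A + 1) n * wp_term \<kappa> B C D n)"
    unfolding pFq_unit_altdef left_term
    by (rule suminf_finite) (auto simp: wp_term_def vanish)
  have right_term: "(\<Prod>a\<leftarrow>Delta2 (\<kappa> - A - 1) @ [B, C, D]. pochhammer a j)
        / ((\<Prod>b\<leftarrow>Delta2 \<kappa> @ [\<kappa> - A, B + C + D - \<kappa> + 1]. pochhammer b j) * fact j)
      = (- 1) ^ j * conn_coeff (\<kappa> - 1 - A) j * (pochhammer B j * pochhammer C j * pochhammer D j)
        / (pochhammer \<kappa> (2 * j) * pochhammer (B + C + D - \<kappa> + 1) j)" for j
  proof -
    have "(\<Prod>a\<leftarrow>Delta2 (\<kappa> - A - 1) @ [B, C, D]. pochhammer a j)
        / ((\<Prod>b\<leftarrow>Delta2 \<kappa> @ [\<kappa> - A, B + C + D - \<kappa> + 1]. pochhammer b j) * fact j)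
      = (pochhammer ((\<kappa> - A - 1) / 2) j * pochhammer ((\<kappa> - A - 1 + 1) / 2) j)
        * (pochhammer B j * pochhammer C j * pochhammer D j)
        / ((pochhammer (\<kappa> / 2) j * pochhammer ((\<kappa> + 1) / 2) j) * pochhammer (\<kappa> - A) j
           * pochhammer (B + C + D - \<kappa> + 1) j * fact j)"
      by (simp add: Delta2_def mult_ac)
    also have "\<dots> = pochhammer (\<kappa> - 1 - A) (2 * j) * (pochhammer B j * pochhammer C j * pochhammer D j)
        / (pochhammer \<kappa> (2 * j) * pochhammer (\<kappa> - A) j * pochhammer (B + C + D - \<kappa> + 1) j * fact j)"
      unfolding pochhammer_Delta2 by (simp add: diff_diff_eq add.commute)
    \<comment> \<open>With \<open>b = \<kappa> - 1 - A\<close>, the doubling formula supplies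
      \<open>(\<kappa> - A)_j\<close> and \<open>j!\<close>, which cancel the denominator.\<close>
    also have "\<dots> = (- 1) ^ j * conn_coeff (\<kappa> - 1 - A) j * (pochhammer B j * pochhammer C j * pochhammer D j)
        / (pochhammer \<kappa> (2 * j) * pochhammer (B + C + D - \<kappa> + 1) j)"
      unfolding pochhammer_double_conn_coeff[of "\<kappa> - 1 - A"]
      using \<kappa>A[of j] by (simp add: diff_diff_eq)
    finally show ?thesis .
  qed
  have right: "pFq_unit (Delta2 (\<kappa> - A - 1) @ [B, C, D]) (Delta2 \<kappa> @ [\<kappa> - A, B + C + D - \<kappa> + 1])
      = (\<Sum>j\<le>N. (- 1) ^ j * conn_coeff (\<kappa> - 1 - A) j
        * (pochhammer B j * pochhammer C j * pochhammer D j)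
        / (pochhammer \<kappa> (2 * j) * pochhammer (B + C + D - \<kappa> + 1) j))"
    unfolding pFq_unit_altdef right_term
    by (rule suminf_finite) (auto simp: vanish)
  have ratio: "pochhammer z N = Gamma (z + of_nat N) / Gamma z" if "z \<notin> \<int>\<^sub>\<le>\<^sub>0" for z :: complex
    using that by (rule pochhammer_Gamma)
  \<comment> \<open>As \<open>D = -N\<close>, the eight Gamma factors pair off with arguments
    differing by \<open>N\<close>, for instance \<open>\<kappa>\<close> with
    \<open>\<kappa> - D\<close>.\<close>
  have prefactor: "pochhammer \<kappa> N * pochhammer (\<kappa> - B - C) N / (pochhammer (\<kappa> - B) N * pochhammer (\<kappa> - C) N)
      = (Gamma (\<kappa> - B) * Gamma (\<kappa> - C) * Gamma (\<kappa> - D) * Gamma (\<kappa> - B - C - D)) /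
         (Gamma \<kappa> * Gamma (\<kappa> - B - C) * Gamma (\<kappa> - B - D) * Gamma (\<kappa> - C - D))"
    using Gamma_args by (simp add: ratio D mult_ac)
  have "\<kappa> + of_nat n \<noteq> 0" "\<kappa> - B + of_nat n \<noteq> 0" "\<kappa> - C + of_nat n \<noteq> 0"
    "\<kappa> - B - C + of_nat n \<noteq> 0" for n
    using Gamma_args by (auto intro!: nonzero)
  note terminating_transformation[OF this, of A N]
  then show ?thesis
    unfolding left right prefactor[symmetric] by (simp add: D)
qed

end
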